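(* Given $1<\alpha<\infty$, $m>0$ and $d\in\mathbf{N}$, there exists $r=r(d,\alpha,m)>0$ such that for every exponent $\beta\ge\alpha$ and all $\xi,\hat\xi\in\mathcal{P}(\mathbf{S}^d)$ with $d_\infty(\xi,\hat\xi)<r$: if $\hat\xi\in\mathcal{P}_\Delta(\mathbf{S}^d)$ and $\hat\xi(\{z,-z\})\ge m$ for each $z\in\operatorname{spt}\hat\xi$, then $E_\beta(\xi)\le E_\beta(\hat\xi)$, and the inequality is strict unless $\xi$ is a rotation of $\hat\xi$.
   Context: $\mathbf{N}=\{1,2,\ldots\}$. $\mathbf{S}^d=\{x\in\mathbf{R}^{d+1}: |x|=1\}$ with geodesic distance $\rho(x,y)=\arccos(x\cdot y)$; $\mathcal{P}(\mathbf{S}^d)$ is the set of Borel probability measures on $\mathbf{S}^d$, and $\operatorname{spt}\mu$ is the smallest closed set of full $\mu$-measure. Put $\Lambda(x,y)=\frac{2}{\pi}\min\{\rho(x,y),\pi-\rho(x,y)\}$. For exponents $\alpha\in(0,\infty]$ set $E_\alpha(\mu)=\frac12\iint\Lambda^\alpha(x,y)\,d\mu(x)\,d\mu(y)$, where $\Lambda^\infty(x,y)=1$ if $x\cdot y=0$ and $0$ otherwise. $\mathcal{P}_\Delta(\mathbf{S}^d)$ is the set of $\mu\in\mathcal{P}(\mathbf{S}^d)$ for which there is an orthonormal basis $V=\{v_0,\ldots,v_d\}$ of $\mathbf{R}^{d+1}$ with $\mu(V\cup -V)=1$ and $\mu(\{v_i,-v_i\})>0$ for every $i$. The $L^\infty$-Kantorovich-Rubinstein-Wasserstein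 distance is $d_\infty(\mu,\nu)=\inf_{\gamma\in\Gamma(\mu,\nu)}\sup_{(x,y)\in\operatorname{spt}\gamma}\rho(x,y)$, where $\Gamma(\mu,\nu)$ is the set of joint probability measures on $\mathbf{S}^d\times\mathbf{S}^d$ with left marginal $\mu$ and right marginal $\nu$. A rotation of $\hat\xi$ is its push-forward under some $M\in SO(d+1)$. *)

theory Defs
  imports "HOL-Probability.Probability"
begin

definition sphere_borel :: "(real^'n) measure" where
  "sphere_borel = restrict_space borel (sphere 0 1)"

definition sphere_prob :: "(real^'n) measure set" where
  "sphere_prob = {\<mu>. prob_space \<mu> \<and> sets \<mu> = sets sphere_borel}"

definition geodesic_dist :: "real^'n \<Rightarrow> real^'n \<Rightarrow> real" where
  "geodesic_dist x y = arccos (x \<bullet> y)"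

definition acute_angle :: "real^'n \<Rightarrow> real^'n \<Rightarrow> real" where
  "acute_angle x y = 2 / pi * min (geodesic_dist x y) (pi - geodesic_dist x y)"

definition kernel :: "ereal \<Rightarrow> real^'n \<Rightarrow> real^'n \<Rightarrow> real" where
  "kernel \<alpha> x y =
     (if \<alpha> = \<infinity> then if x \<bullet> y = 0 then 1 else 0
      else acute_angle x y powr real_of_ereal \<alpha>)"

definition energy :: "ereal \<Rightarrow> (real^'n) measure \<Rightarrow> real" where
  "energy \<alpha> \<mu> = 1 / 2 * (\<integral>x. (\<integral>y. kernel \<alpha> x y \<partial>\<mu>) \<partial>\<mu>)"

text \<open>
  Below, \<open>spt\<close> is only applied to Borel measures whose space is the sphere or the product of two
  spheres. These spaces are closed, so their relatively closed subsets are precisely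
  the closed sets of the ambient type that they contain.
\<close>

definition spt :: "'a::topological_space measure \<Rightarrow> 'a set" where
  "spt \<mu> = \<Inter>{C. closed C \<and> C \<subseteq> space \<mu> \<and> emeasure \<mu> C = emeasure \<mu> (space \<mu>)}"

definition orthonormal_basis :: "(real^'n) set \<Rightarrow> bool" where
  "orthonormal_basis V \<longleftrightarrow> pairwise orthogonal V \<and> (\<forall>v\<in>V. norm v = 1) \<and> span V = UNIV"

definition sphere_prob_simplex :: "(real^'n) measure set" where
  "sphere_prob_simplex = {\<mu> \<in> sphere_prob.
     \<exists>V. orthonormal_basis V \<and> measure \<mu> (V \<union> uminus ` V) = 1 \<and>
         (\<forall>v\<in>V. measure \<mu> {v, - v} > 0)}"

definition couplings ::
    "(real^'n) measure \<Rightarrow> (real^'n) measure \<Rightarrow> ((real^'n) \<times> (real^'n)) measure set" where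
  "couplings \<mu> \<nu> = {\<gamma>. prob_space \<gamma> \<and> sets \<gamma> = sets (sphere_borel \<Otimes>\<^sub>M sphere_borel) \<and>
     distr \<gamma> sphere_borel fst = \<mu> \<and> distr \<gamma> sphere_borel snd = \<nu>}"

definition d_infty :: "(real^'n) measure \<Rightarrow> (real^'n) measure \<Rightarrow> real" where
  "d_infty \<mu> \<nu> = (INF \<gamma>\<in>couplings \<mu> \<nu>. SUP (x, y)\<in>spt \<gamma>. geodesic_dist x y)"

definition is_rotation_of :: "(real^'n) measure \<Rightarrow> (real^'n) measure \<Rightarrow> bool" where
  "is_rotation_of \<nu> \<mu> \<longleftrightarrow> (\<exists>M. rotation_matrix M \<and> \<nu> = distr \<mu> sphere_borel ((*v) M))"


text \<open>
  The intersection defining \<open>spt\<close> is itself one of the sets intersected, so it is the smallest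
  closed set of full measure. In particular it is nonempty for probability measures.
\<close>

lemma spt_smallest_full:
  fixes \<mu> :: "'a::second_countable_topology measure"
  assumes "finite_measure \<mu>" "closed (space \<mu>)" "sets \<mu> = sets (restrict_space borel (space \<mu>))"
  shows "closed (spt \<mu>)" "spt \<mu> \<subseteq> space \<mu>" "emeasure \<mu> (spt \<mu>) = emeasure \<mu> (space \<mu>)"
proof -
  interpret finite_measure \<mu> by fact
  define F where "F = {C. closed C \<and> C \<subseteq> space \<mu> \<and> emeasure \<mu> C = emeasure \<mu> (space \<mu>)}"
  have spt: "spt \<mu> = \<Inter>F" by (simp add: spt_def F_def)
  show cl: "closed (spt \<mu>)" unfolding spt by (rule closed_Inter) (simp add: F_def)
  have sp: "space \<mu> \<in> F" using assms(2) by (simp add: F_def)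
  then show sub: "spt \<mu> \<subseteq> space \<mu>" unfolding spt by (rule Inter_lower)
  have meas: "C \<in> sets \<mu>" if "closed C" "C \<subseteq> space \<mu>" for C
  proof -
    have eq: "space \<mu> \<inter> C = C" using that by blast
    have "C \<in> sets borel" using that by simp
    then have "space \<mu> \<inter> C \<in> sets (restrict_space borel (space \<mu>))"
      unfolding sets_restrict_space by (rule imageI)
    then show ?thesis unfolding eq assms(3)[symmetric] .
  qed
  obtain F' where F': "F' \<subseteq> uminus ` F" "countable F'" "\<Union>F' = \<Union>(uminus ` F)"
  proof (rule Lindelof[of "uminus ` F"])
    show "open S" if "S \<in> uminus ` F" for S
      using that by (auto simp: F_def open_Compl)
  qed
  have null: "U \<inter> space \<mu> \<in> null_sets \<mu>" if U: "U \<in> F'" for U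
  proof -
    obtain C where C: "C \<in> F" "U = - C" using U F'(1) by blast
    then have m: "C \<in> sets \<mu>" by (simp add: F_def meas)
    have "U \<inter> space \<mu> = space \<mu> - C" using C by blast
    moreover have "emeasure \<mu> (space \<mu> - C) = 0"
      using C m by (subst emeasure_compl) (auto simp: F_def)
    ultimately show ?thesis using m by (auto simp: null_sets_def)
  qed
  have "space \<mu> - spt \<mu> = (\<Union>U\<in>F'. U \<inter> space \<mu>)"
    using F'(3) unfolding spt by blast
  also have "\<dots> \<in> null_sets \<mu>"
    by (rule null_sets_UN'[OF F'(2) null])
  finally have "space \<mu> - spt \<mu> \<in> null_sets \<mu>" .
  then have "emeasure \<mu> (space \<mu> - (space \<mu> - spt \<mu>)) = emeasure \<mu> (space \<mu>)"
    by (intro emeasure_Diff_null_set) auto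
  moreover have "space \<mu> - (space \<mu> - spt \<mu>) = spt \<mu>" using sub by blast
  ultimately show "emeasure \<mu> (spt \<mu>) = emeasure \<mu> (space \<mu>)" by simp
qed

end

theory Submission
  imports Defs
begin

text \<open>
  Let \<open>V\<close> be the frame carrying \<open>\<xi>'\<close>. A coupling at small uniform distance confines \<open>\<xi>\<close> to small
  caps around \<open>\<plusminus>v\<close>, \<open>v \<in> V\<close>, with the same cap masses as \<open>\<xi>'\<close>. The kernel decreases in the exponent,
  so the finite exponent \<open>a > 1\<close> dominates all others. Moving from \<open>\<xi>'\<close> to \<open>\<xi>\<close> loses at least
  \<open>2 / pi * \<bar>x \<bullet> y\<bar>\<close> for points \<open>x, y\<close> of different caps. It gains
  at most \<open>\<bar>x - y\<bar> powr a\<close> for points of one cap (up to sign), and this is a small multiple of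
  \<open>\<bar>x - y\<bar>\<close> because \<open>a > 1\<close>. But \<open>x - y\<close> is almost orthogonal to the axis of that cap, hence
  \<open>\<bar>x - y\<bar>\<close> is controlled by its inner products with points of the other caps, that is, by the loss
  at \<open>x\<close> and at \<open>y\<close>; each of the other caps has mass at least \<open>m\<close>. So the loss wins, and if it
  vanishes, each cap carries a single point up to sign and these points are orthonormal.
\<close>

section \<open>Caps around an orthonormal frame\<close>

text \<open>The two antipodal caps are taken together because the kernel ignores signs. The radius
  is a chord length, not an arc, so that later estimates are estimates of norms.\<close>

definition cap :: "real \<Rightarrow> real^'n \<Rightarrow> (real^'n) set" where
  "cap \<delta> v = {x. norm x = 1 \<and> (norm (x - v) < \<delta> \<or> norm (x + v) < \<delta>)}"

section \<open>Chords, arcs and acute angles on the sphere\<close>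

text \<open>Jordan's inequality: the sine is concave on \<open>{0..pi/2}\<close> and so lies above
  its chord there.\<close>

lemma two_over_pi_mult_le_sin:
  fixes t :: real
  assumes "0 \<le> t" "t \<le> pi / 2"
  shows "2 / pi * t \<le> sin t"
proof -
  have "concave_on {0..pi/2} sin"
    by (rule f''_le0_imp_concave[where f' = cos and f'' = "\<lambda>x. - sin x"])
      (auto intro!: derivative_eq_intros sin_ge_zero)
  from concave_onD[OF this, of "2 / pi * t" 0 "pi / 2"] show ?thesis
    using assms by (simp add: field_simps)
qed

lemma abs_inner_le_1:
  fixes x y :: "real^'n"
  assumes "norm x = 1" "norm y = 1"
  shows "\<bar>x \<bullet> y\<bar> \<le> 1" "- 1 \<le> x \<bullet> y" "x \<bullet> y \<le> 1"
  using Cauchy_Schwarz_ineq2[of x y] assms by auto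

lemma geodesic_dist_bounds:
  assumes "norm x = 1" "norm y = 1"
  shows "0 \<le> geodesic_dist x y" "geodesic_dist x y \<le> pi"
    "cos (geodesic_dist x y) = x \<bullet> y"
  using abs_inner_le_1[OF assms]
  by (auto simp: geodesic_dist_def arccos_lbound arccos_ubound)

lemma norm_diff_eq_2_sin:
  assumes "norm x = 1" "norm y = 1"
  shows "norm (x - y) = 2 * sin (geodesic_dist x y / 2)"
proof -
  let ?r = "geodesic_dist x y"
  note r = geodesic_dist_bounds[OF assms]
  have "x \<bullet> x = 1" "y \<bullet> y = 1" using assms by (simp_all add: norm_eq_1)
  then have "(norm (x - y))\<^sup>2 = 2 - 2 * cos (2 * (?r / 2))"
    using r(3) by (simp add: power2_norm_eq_inner inner_diff inner_commute)
  also have "\<dots> = (2 * sin (?r / 2))\<^sup>2"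
    unfolding cos_double_sin by (simp add: power2_eq_square)
  finally show ?thesis
    using r by (subst (asm) power2_eq_iff_nonneg) (auto intro!: sin_ge_zero)
qed

lemma norm_diff_le_geodesic_dist:
  assumes "norm x = 1" "norm y = 1"
  shows "norm (x - y) \<le> geodesic_dist x y"
  using norm_diff_eq_2_sin[OF assms] sin_x_le_x[of "geodesic_dist x y / 2"]
    geodesic_dist_bounds[OF assms] by simp

text \<open>Once the minimum is dropped, this is Jordan's inequality at half the geodesic distance.
  The normalisation \<open>2 / pi\<close> of the angle is what makes the constant 1.\<close>

lemma acute_angle_le_norm_diff:
  assumes "norm x = 1" "norm y = 1"
  shows "acute_angle x y \<le> norm (x - y)"
proof -
  let ?r = "geodesic_dist x y"
  note r = geodesic_dist_bounds[OF assms]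
  have "acute_angle x y \<le> 2 / pi * ?r"
    unfolding acute_angle_def by (intro mult_left_mono) auto
  also have "\<dots> = 2 * (2 / pi * (?r / 2))" by simp
  also have "\<dots> \<le> norm (x - y)"
    unfolding norm_diff_eq_2_sin[OF assms]
    by (intro mult_left_mono two_over_pi_mult_le_sin) (use r in auto)
  finally show ?thesis .
qed

lemma geodesic_dist_minus:
  assumes "norm x = 1" "norm y = 1"
  shows "geodesic_dist x (- y) = pi - geodesic_dist x y"
  using abs_inner_le_1[OF assms] by (simp add: geodesic_dist_def arccos_minus)

lemma acute_angle_minus:
  assumes "norm x = 1" "norm y = 1"
  shows "acute_angle x (- y) = acute_angle x y"
  by (simp add: acute_angle_def geodesic_dist_minus[OF assms] min.commute)

lemma acute_angle_nonneg:
  assumes "norm x = 1" "norm y = 1"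
  shows "0 \<le> acute_angle x y"
  using geodesic_dist_bounds[OF assms] by (simp add: acute_angle_def)

text \<open>The inner product is the sine of the deviation of the arc from \<open>pi / 2\<close>,
  and the deviation dominates its sine. Near orthogonality the angle therefore drops at least
  linearly, which is the source of the energy loss.\<close>

lemma acute_angle_le_one_minus_inner:
  assumes "norm x = 1" "norm y = 1"
  shows "acute_angle x y \<le> 1 - 2 / pi * \<bar>x \<bullet> y\<bar>"
proof -
  let ?r = "geodesic_dist x y"
  have "\<bar>x \<bullet> y\<bar> = \<bar>sin (pi / 2 - ?r)\<bar>"
    using geodesic_dist_bounds[OF assms] by (simp add: sin_diff)
  also have "\<dots> \<le> \<bar>pi / 2 - ?r\<bar>" by (rule abs_sin_x_le_abs_x)
  finally have "min ?r (pi - ?r) \<le> pi / 2 - \<bar>x \<bullet> y\<bar>" by linarith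
  then have "2 / pi * min ?r (pi - ?r) \<le> 2 / pi * (pi / 2 - \<bar>x \<bullet> y\<bar>)"
    by (intro mult_left_mono) auto
  then show ?thesis by (simp add: acute_angle_def algebra_simps)
qed

lemma acute_angle_le_1:
  assumes "norm x = 1" "norm y = 1"
  shows "acute_angle x y \<le> 1"
  using acute_angle_le_one_minus_inner[OF assms]
  by (smt (verit) divide_nonneg_pos mult_nonneg_nonneg pi_gt_zero)

lemma acute_angle_orthogonal: "x \<bullet> y = 0 \<Longrightarrow> acute_angle x y = 1"
  by (simp add: acute_angle_def geodesic_dist_def)

section \<open>Bounds and special values of the kernel\<close>

text \<open>The angle lies between 0 and 1, so its powers decrease in the exponent. For the infinite
  exponent the kernel is nonzero only at orthogonal points, where the angle is 1.\<close>

lemma kernel_le_powr: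
  assumes "norm x = 1" "norm y = 1" "ereal a \<le> \<beta>"
  shows "kernel \<beta> x y \<le> acute_angle x y powr a"
proof (cases \<beta>)
  case (real b)
  then show ?thesis
    using assms acute_angle_nonneg[OF assms(1,2)] acute_angle_le_1[OF assms(1,2)]
    by (cases "acute_angle x y = 0") (auto simp: kernel_def intro!: powr_mono')
qed (use assms in \<open>auto simp: kernel_def acute_angle_orthogonal\<close>)

lemma kernel_orthogonal: "x \<bullet> y = 0 \<Longrightarrow> kernel \<beta> x y = 1"
  by (simp add: kernel_def acute_angle_orthogonal)

lemma kernel_self_or_minus:
  assumes "norm x = 1" "y = x \<or> y = - x"
  shows "kernel \<beta> x y = 0"
proof -
  have xx: "x \<bullet> x = 1" using assms by (simp add: norm_eq_1)
  show ?thesis using assms(2) xx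
    by (auto simp: kernel_def acute_angle_def geodesic_dist_def)
qed

section \<open>Caps and orthonormal frames\<close>

lemma cap_minus: "- x \<in> cap \<delta> v \<longleftrightarrow> x \<in> cap \<delta> v"
proof -
  have "- x - v = - (x + v)" "- x + v = - (x - v)" by auto
  then have "norm (- x - v) = norm (x + v)" "norm (- x + v) = norm (x - v)"
    by (metis norm_minus_cancel)+
  then show ?thesis by (auto simp: cap_def)
qed

lemma cap_sign:
  assumes "x \<in> cap \<delta> v"
  obtains s where "s = 1 \<or> s = - 1" "norm (s *\<^sub>R x - v) < \<delta>"
proof -
  have "- x - v = - (x + v)" by auto
  then have "norm (- x - v) = norm (x + v)" by (metis norm_minus_cancel)
  then show ?thesis using assms that[of 1] that[of "- 1"] by (auto simp: cap_def)
qed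

lemma cap_borel: "cap \<delta> v \<in> sets borel"
proof -
  have "cap \<delta> v = sphere 0 1 \<inter> (ball v \<delta> \<union> ball (- v) \<delta>)"
    by (auto simp: cap_def dist_norm norm_minus_commute[of v] norm_minus_commute[of "- v"])
  then show ?thesis by simp
qed

lemma orthonormal_basis_finite:
  assumes "orthonormal_basis (V :: (real^'n) set)"
  shows "finite V" "card V = CARD('n)"
proof -
  have "0 \<notin> V" using assms by (auto simp: orthonormal_basis_def)
  then have ind: "independent V"
    using assms by (simp add: orthonormal_basis_def pairwise_orthogonal_independent)
  then show "finite V" by (rule independent_imp_finite)
  show "card V = CARD('n)"
    using ind assms dim_eq_card[of V V] dim_span[of V] by (simp add: orthonormal_basis_def dim_eq_card_independent)
qed

lemma orthonormal_basis_inner: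
  assumes "orthonormal_basis V" "u \<in> V" "v \<in> V"
  shows "u \<bullet> v = (if u = v then 1 else 0)"
  using assms by (auto simp: orthonormal_basis_def pairwise_def orthogonal_def norm_eq_1)

text \<open>The residual is orthogonal to \<open>V\<close>, hence to the span of \<open>V\<close>,
  which contains the residual itself.\<close>

lemma orthonormal_basis_expansion:
  assumes "orthonormal_basis V"
  shows "(\<Sum>v\<in>V. (x \<bullet> v) *\<^sub>R v) = x"
proof -
  have [simp]: "finite V" using orthonormal_basis_finite[OF assms] by simp
  define y where "y = x - (\<Sum>v\<in>V. (x \<bullet> v) *\<^sub>R v)"
  have "y \<bullet> u = 0" if "u \<in> V" for u
  proof -
    have "(\<Sum>v\<in>V. (x \<bullet> v) *\<^sub>R v) \<bullet> u = (\<Sum>v\<in>V. if v = u then x \<bullet> u else 0)"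
      unfolding inner_sum_left
      by (intro sum.cong) (use orthonormal_basis_inner[OF assms] that in auto)
    then show ?thesis using that by (simp add: y_def inner_diff)
  qed
  moreover have "y \<in> span V" using assms by (simp add: orthonormal_basis_def)
  ultimately have "orthogonal y y"
    by (meson orthogonal_def orthogonal_to_span)
  then have "y = 0" by (simp add: orthogonal_self)
  then show ?thesis by (simp add: y_def)
qed

text \<open>Otherwise suitable signs would bring \<open>u\<close> and \<open>v\<close> within a
  distance less than \<open>2 * \<delta>\<close>, hence less than 1, while distinct frame vectors
  are \<open>sqrt 2\<close> apart whatever their signs.\<close>

lemma cap_disjoint:
  assumes V: "orthonormal_basis V" "u \<in> V" "v \<in> V" and "\<delta> \<le> 1 / 2"
    and x: "x \<in> cap \<delta> u" "x \<in> cap \<delta> v"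
  shows "u = v"
proof (rule ccontr)
  assume ne: "u \<noteq> v"
  obtain s where s: "s = 1 \<or> s = - 1" "norm (s *\<^sub>R x - u) < \<delta>" by (rule cap_sign[OF x(1)])
  obtain t where t: "t = 1 \<or> t = - 1" "norm (t *\<^sub>R x - v) < \<delta>" by (rule cap_sign[OF x(2)])
  have uv: "u \<bullet> u = 1" "v \<bullet> v = 1" "u \<bullet> v = 0" "v \<bullet> u = 0"
    using orthonormal_basis_inner[OF V(1)] V ne by auto
  have "s *\<^sub>R u - t *\<^sub>R v = t *\<^sub>R (t *\<^sub>R x - v) - s *\<^sub>R (s *\<^sub>R x - u)"
    using s(1) t(1) by auto
  then have "norm (s *\<^sub>R u - t *\<^sub>R v) \<le> norm (t *\<^sub>R (t *\<^sub>R x - v)) + norm (s *\<^sub>R (s *\<^sub>R x - u))"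
    by (metis norm_triangle_ineq4)
  also have "\<dots> < 1" using s t assms(4) by auto
  finally have "(norm (s *\<^sub>R u - t *\<^sub>R v))\<^sup>2 < 1"
    by (simp add: power_less_one_iff abs_square_less_1)
  moreover have "(norm (s *\<^sub>R u - t *\<^sub>R v))\<^sup>2 = 2"
    unfolding power2_norm_eq_inner using s(1) t(1) uv by (auto simp: inner_diff)
  ultimately show False by simp
qed

text \<open>For small \<open>\<delta>\<close> the last term can be absorbed on the left, so the
  components along the other axes alone control the distance of two points near
  \<open>v\<close>.\<close>

lemma norm_diff_le_sum_inner:
  assumes V: "orthonormal_basis V" "v \<in> V" and "norm a = 1" "norm b = 1"
    and "norm (a - v) < \<delta>" "norm (b - v) < \<delta>"
  shows "norm (a - b) \<le> (\<Sum>u\<in>V - {v}. \<bar>(a - b) \<bullet> u\<bar>) + \<delta> * norm (a - b)"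
proof -
  let ?z = "a - b"
  note fin = orthonormal_basis_finite(1)[OF V(1)]
  have "norm ?z = norm (\<Sum>u\<in>V. (?z \<bullet> u) *\<^sub>R u)"
    by (simp only: orthonormal_basis_expansion[OF V(1)])
  also have "\<dots> \<le> (\<Sum>u\<in>V. \<bar>?z \<bullet> u\<bar>)"
    using V by (intro sum_norm_le) (auto simp: orthonormal_basis_def)
  also have "\<dots> = \<bar>?z \<bullet> v\<bar> + (\<Sum>u\<in>V - {v}. \<bar>?z \<bullet> u\<bar>)"
    by (rule sum.remove[OF fin V(2)])
  finally have 1: "norm ?z \<le> \<bar>?z \<bullet> v\<bar> + (\<Sum>u\<in>V - {v}. \<bar>?z \<bullet> u\<bar>)" .
  \<comment> \<open>\<open>a - b\<close> is orthogonal to \<open>a + b\<close>, so its component along \<open>v\<close> is negligible.\<close>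
  have "a \<bullet> a = 1" "b \<bullet> b = 1" using assms by (simp_all add: norm_eq_1)
  then have "2 * (?z \<bullet> v) = ?z \<bullet> (2 *\<^sub>R v - a - b)"
    by (simp add: inner_diff_left inner_diff_right inner_commute)
  also have "2 *\<^sub>R v - a - b = (v - a) + (v - b)" by (simp add: scaleR_2)
  finally have "2 * (?z \<bullet> v) = ?z \<bullet> ((v - a) + (v - b))" .
  then have "2 * \<bar>?z \<bullet> v\<bar> \<le> norm ?z * norm ((v - a) + (v - b))"
    using Cauchy_Schwarz_ineq2[of ?z "(v - a) + (v - b)"] by linarith
  also have "\<dots> \<le> norm ?z * (\<delta> + \<delta>)"
    using assms norm_triangle_ineq[of "v - a" "v - b"]
    by (intro mult_left_mono) (auto simp: norm_minus_commute[of v])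
  finally show ?thesis using 1 by (simp add: algebra_simps)
qed

text \<open>An orthogonal matrix of determinant \<open>- 1\<close> has the eigenvalue \<open>- 1\<close>.\<close>

lemma rotation_matrix_if_near_id:
  fixes M :: "real^'n^'n"
  assumes M: "orthogonal_matrix M" and near: "\<And>x. x \<noteq> 0 \<Longrightarrow> norm (M *v x - x) < 2 * norm x"
  shows "rotation_matrix M"
proof (rule ccontr)
  assume "\<not> rotation_matrix M"
  then have d: "det M = - 1"
    using det_orthogonal_matrix[OF M] M by (auto simp: rotation_matrix_def)
  \<comment> \<open>Taking determinants, and using that transposition preserves them, gives
    \<open>det (mat 1 + M) = - det (mat 1 + M)\<close>.\<close>
  have "M ** (mat 1 + transpose M) = mat 1 + M"
    using M by (simp add: matrix_add_ldistrib orthogonal_matrix_def orthogonal_matrix add.commute)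
  then have "det (mat 1 + M) = det M * det (mat 1 + transpose M)" by (metis det_mul)
  also have "mat 1 + transpose M = transpose (mat 1 + M)"
    by (simp add: transpose_def vec_eq_iff mat_def)
  finally have "det (mat 1 + M) = 0" using d by (simp add: det_transpose)
  then have "\<not> invertible (mat 1 + M)" by (simp add: invertible_det_nz)
  then obtain x where x: "(mat 1 + M) *v x = 0" "x \<noteq> 0"
    by (metis invertible_left_inverse matrix_left_invertible_ker)
  then have "M *v x = - x"
    by (simp add: matrix_vector_mult_add_rdistrib eq_neg_iff_add_eq_0 add.commute)
  then have "norm (M *v x - x) = norm (2 *\<^sub>R x)"
    by (metis norm_minus_cancel minus_diff_eq diff_minus_eq_add scaleR_2)
  then show False using near[OF x(2)] by simp
qed

section \<open>Measures concentrated near an orthonormal frame\<close>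

text \<open>When the caps are disjoint, this is the indicator of not sharing a cap
  (\<open>sep_eq\<close>). The form as a sum of products makes it measurable and lets its double
  integral factor into squares of cap masses.\<close>

definition sep :: "(real^'n) set \<Rightarrow> real \<Rightarrow> real^'n \<Rightarrow> real^'n \<Rightarrow> real" where
  "sep V \<delta> x y = 1 - (\<Sum>v\<in>V. indicator (cap \<delta> v) x * indicator (cap \<delta> v) y)"

lemma sep_eq:
  assumes "orthonormal_basis V" "\<delta> \<le> 1 / 2"
  shows "sep V \<delta> x y = (if \<exists>v\<in>V. x \<in> cap \<delta> v \<and> y \<in> cap \<delta> v then 0 else 1)"
proof (cases "\<exists>v\<in>V. x \<in> cap \<delta> v \<and> y \<in> cap \<delta> v")
  case True
  then obtain v where v: "v \<in> V" "x \<in> cap \<delta> v" "y \<in> cap \<delta> v" by blast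
  have fin: "finite V" by (rule orthonormal_basis_finite(1)[OF assms(1)])
  have "indicator (cap \<delta> u) x * indicator (cap \<delta> u) y = (if u = v then 1 else 0 :: real)"
    if "u \<in> V" for u
  proof (cases "u = v")
    case False
    then have "x \<notin> cap \<delta> u"
      using cap_disjoint[OF assms(1) that v(1) assms(2) _ v(2)] by blast
    with False show ?thesis by simp
  qed (use v in simp)
  then have "(\<Sum>u\<in>V. indicator (cap \<delta> u) x * indicator (cap \<delta> u) y :: real) =
      (\<Sum>u\<in>V. if u = v then 1 else 0)"
    by (rule sum.cong[OF refl])
  then show ?thesis using True v(1) fin by (simp add: sep_def)
next
  case False
  then have "(\<Sum>u\<in>V. indicator (cap \<delta> u) x * indicator (cap \<delta> u) y :: real) = 0"
    by (intro sum.neutral) (auto simp: indicator_def)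
  with False show ?thesis by (simp add: sep_def)
qed

lemma sep_minus: "sep V \<delta> (- x) y = sep V \<delta> x y"
  by (simp add: sep_def indicator_def cap_minus)

locale sphere_prob_space = prob_space \<xi> for \<xi> :: "(real^'n) measure" +
  assumes sets_eq [measurable_cong]: "sets \<xi> = sets sphere_borel"
begin

lemma space_eq: "space \<xi> = sphere 0 1"
  using sets_eq_imp_space_eq[OF sets_eq] by (simp add: sphere_borel_def space_restrict_space)

lemma norm_eq: "x \<in> space \<xi> \<Longrightarrow> norm x = 1"
  by (simp add: space_eq)

lemma ident_measurable [measurable]: "(\<lambda>x. x) \<in> borel_measurable \<xi>"
  unfolding measurable_cong_sets[OF sets_eq refl] sphere_borel_def
  by (rule measurable_restrict_space1) simp

lemma cap_sets [measurable]: "cap \<delta> v \<in> sets \<xi>"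
proof -
  have "cap \<delta> v = sphere 0 1 \<inter> cap \<delta> v" by (auto simp: cap_def)
  then show ?thesis
    unfolding sets_eq sphere_borel_def sets_restrict_space using cap_borel[of \<delta> v] by blast
qed

lemma sep_measurable [measurable]:
  "(\<lambda>(x, y). sep V \<delta> x y) \<in> borel_measurable (\<xi> \<Otimes>\<^sub>M \<xi>)"
  unfolding sep_def by measurable

lemma kernel_measurable [measurable]:
  "(\<lambda>(x, y). kernel \<beta> x y) \<in> borel_measurable (\<xi> \<Otimes>\<^sub>M \<xi>)"
proof -
  \<comment> \<open>Clamping the argument to the interval from -1 to 1 makes \<open>arccos\<close>
    continuous on the whole line. For unit vectors the clamp changes nothing.\<close>
  have "continuous_on UNIV (\<lambda>t::real. arccos (max (- 1) (min 1 t)))"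
    by (intro continuous_intros) auto
  then have [measurable]: "(\<lambda>t::real. arccos (max (- 1) (min 1 t))) \<in> borel_measurable borel"
    by (rule borel_measurable_continuous_onI)
  have "(\<lambda>(x, y). arccos (max (- 1) (min 1 (x \<bullet> y)))) \<in> borel_measurable (\<xi> \<Otimes>\<^sub>M \<xi>)"
    by measurable
  also have "?this \<longleftrightarrow> (\<lambda>(x, y). geodesic_dist x y) \<in> borel_measurable (\<xi> \<Otimes>\<^sub>M \<xi>)"
    using abs_inner_le_1(2,3)[OF norm_eq norm_eq]
    by (intro measurable_cong)
      (auto simp: space_pair_measure geodesic_dist_def min_absorb2 max_absorb2)
  finally have [measurable]: "(\<lambda>(x, y). geodesic_dist x y) \<in> borel_measurable (\<xi> \<Otimes>\<^sub>M \<xi>)" .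
  show ?thesis unfolding kernel_def acute_angle_def by measurable
qed

end

section \<open>Measures covered by the caps, and their leak\<close>

text \<open>Both measures of the theorem become instances, with the same frame and radius. The bound
  on \<open>\<delta>\<close> keeps the caps disjoint.\<close>

locale clustered = sphere_prob_space \<xi> for \<xi> :: "(real^'n) measure" +
  fixes V :: "(real^'n) set" and \<delta> :: real
  assumes V: "orthonormal_basis V" and \<delta>: "\<delta> \<le> 1 / 2"
    and covered: "AE x in \<xi>. \<exists>v\<in>V. x \<in> cap \<delta> v"
begin

sublocale P: pair_prob_space \<xi> \<xi> ..

lemma finite_V: "finite V" by (rule orthonormal_basis_finite(1)[OF V])

lemmas sep_if = sep_eq[OF V \<delta>]

lemma sep_bounds: "0 \<le> sep V \<delta> x y" "sep V \<delta> x y \<le> 1"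
  by (auto simp: sep_if)

lemma sep_distinct:
  assumes "v \<in> V" "u \<in> V" "v \<noteq> u" "x \<in> cap \<delta> v" "y \<in> cap \<delta> u"
  shows "sep V \<delta> x y = 1"
proof -
  have "\<not> (w \<in> V \<and> x \<in> cap \<delta> w \<and> y \<in> cap \<delta> w)" for w
    using cap_disjoint[OF V _ assms(1) \<delta> _ assms(4), of w]
      cap_disjoint[OF V _ assms(2) \<delta> _ assms(5), of w] assms(3) by blast
  then show ?thesis unfolding sep_if by (simp add: Bex_def)
qed

text \<open>Up to the factor \<open>2 / pi\<close>, the first-order energy loss at \<open>x\<close>:
  the total failure of \<open>x\<close> to be orthogonal to the mass in the other caps.\<close>

definition leak :: "real^'n \<Rightarrow> real" where
  "leak x = (\<integral>y. sep V \<delta> x y * \<bar>x \<bullet> y\<bar> \<partial>\<xi>)"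

lemma leak_measurable [measurable]: "leak \<in> borel_measurable \<xi>"
  unfolding leak_def by measurable

lemma sep_inner_bounds:
  assumes "norm x = 1" "norm y = 1"
  shows "0 \<le> sep V \<delta> x y * \<bar>x \<bullet> y\<bar>" "sep V \<delta> x y * \<bar>x \<bullet> y\<bar> \<le> 1"
  using abs_inner_le_1(1)[OF assms] by (auto simp: sep_if)

lemma section_measurable:
  assumes "norm x = 1" "(\<lambda>(x, y). f x y) \<in> borel_measurable (\<xi> \<Otimes>\<^sub>M \<xi>)"
  shows "f x \<in> borel_measurable \<xi>"
  using measurable_Pair2[OF assms(2), of x] assms(1) by (simp add: space_eq)

lemma sep_inner_integrable:
  assumes "norm x = 1"
  shows "integrable \<xi> (\<lambda>y. sep V \<delta> x y * \<bar>x \<bullet> y\<bar>)"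
proof (rule integrable_const_bound[where B = 1])
  show "AE y in \<xi>. norm (sep V \<delta> x y * \<bar>x \<bullet> y\<bar>) \<le> 1"
    using sep_inner_bounds[OF assms norm_eq] by (intro AE_I2) auto
  show "(\<lambda>y. sep V \<delta> x y * \<bar>x \<bullet> y\<bar>) \<in> borel_measurable \<xi>"
    by (rule section_measurable[OF assms]) measurable
qed

lemma leak_bounds:
  assumes "norm x = 1"
  shows "0 \<le> leak x" "leak x \<le> 1"
proof -
  show "0 \<le> leak x" unfolding leak_def
    by (intro integral_nonneg_AE AE_I2 sep_inner_bounds assms norm_eq)
  have "leak x \<le> (\<integral>y. 1 \<partial>\<xi>)" unfolding leak_def
    by (intro integral_mono sep_inner_integrable assms sep_inner_bounds norm_eq) auto
  then show "leak x \<le> 1" by (simp add: prob_space)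
qed

lemma leak_integrable: "integrable \<xi> leak"
proof (rule integrable_const_bound[where B = 1])
  show "AE x in \<xi>. norm (leak x) \<le> 1"
    using leak_bounds[OF norm_eq] by (intro AE_I2) simp
qed measurable

lemma leak_minus: "leak (- x) = leak x"
  by (simp add: leak_def sep_minus)

lemma sep_integrable:
  assumes "norm x = 1"
  shows "integrable \<xi> (sep V \<delta> x)"
proof (rule integrable_const_bound[where B = 1])
  show "AE y in \<xi>. norm (sep V \<delta> x y) \<le> 1"
    by (simp add: sep_bounds)
qed (rule section_measurable[OF assms sep_measurable])

lemma cap_integrable: "integrable \<xi> (indicator (cap \<delta> v) :: _ \<Rightarrow> real)"
  by (intro integrable_real_indicator cap_sets) (simp add: emeasure_eq_measure)

lemma integral_sep:
  "(\<integral>y. sep V \<delta> x y \<partial>\<xi>) = 1 - (\<Sum>v\<in>V. indicator (cap \<delta> v) x * prob (cap \<delta> v))"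
proof -
  have "integrable \<xi> (\<lambda>y. indicator (cap \<delta> v) x * indicator (cap \<delta> v) y :: real)" for v
    by (intro integrable_mult_right cap_integrable)
  then show ?thesis
    unfolding sep_def by (simp add: Bochner_Integration.integral_sum prob_space)
qed

lemma double_integral_sep:
  "(\<integral>x. (\<integral>y. sep V \<delta> x y \<partial>\<xi>) \<partial>\<xi>) = 1 - (\<Sum>v\<in>V. (prob (cap \<delta> v))\<^sup>2)"
proof -
  have "integrable \<xi> (\<lambda>x. indicator (cap \<delta> v) x * prob (cap \<delta> v) :: real)" for v
    by (intro integrable_mult_left cap_integrable)
  then show ?thesis
    unfolding integral_sep
    by (simp add: Bochner_Integration.integral_sum prob_space power2_eq_square)
qed

text \<open>The components of \<open>a - b\<close> along the other axes are averaged over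
  \<open>\<xi>\<close>, with the axis of a cap replaced by a point of that cap. Each cap weighs at
  least \<open>m\<close>, which gives the factor \<open>1 / m\<close>; absorbing the replacement
  errors gives the factor 2.\<close>

lemma norm_diff_le_leak:
  assumes v: "v \<in> V" and a: "norm a = 1" "norm (a - v) < \<delta>" and b: "norm b = 1" "norm (b - v) < \<delta>"
    and m: "0 < m" "\<And>u. u \<in> V \<Longrightarrow> m \<le> prob (cap \<delta> u)" and \<delta>m: "\<delta> * (1 / m + 1) \<le> 1 / 2"
  shows "norm (a - b) \<le> 2 / m * (leak a + leak b)"
proof -
  let ?z = "a - b"
  \<comment> \<open>For a given \<open>y\<close> at most one summand survives, the one of the cap
    containing \<open>y\<close>. The last term of \<open>h\<close> below pays for replacing the axis
    of that cap by \<open>y\<close> or \<open>- y\<close>.\<close>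
  define \<phi> where "\<phi> y = (\<Sum>u\<in>V - {v}. \<bar>?z \<bullet> u\<bar> * indicator (cap \<delta> u) y)" for y
  define h where "h y = sep V \<delta> a y * \<bar>a \<bullet> y\<bar> + sep V \<delta> b y * \<bar>b \<bullet> y\<bar> + \<delta> * norm ?z" for y
  have "0 < \<delta>" using a(2) norm_ge_zero[of "a - v"] by linarith
  have ab: "a \<in> cap \<delta> v" "b \<in> cap \<delta> v" using a b by (auto simp: cap_def)
  have h0: "0 \<le> h y" for y
    unfolding h_def using sep_bounds \<open>0 < \<delta>\<close> by (intro add_nonneg_nonneg mult_nonneg_nonneg) auto
  have le: "\<phi> y \<le> h y" if y: "norm y = 1" for y
  proof (cases "\<exists>u\<in>V - {v}. y \<in> cap \<delta> u")
    case True
    then obtain u where u: "u \<in> V - {v}" "y \<in> cap \<delta> u" by blast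
    have uniq: "w = u" if "w \<in> V" "y \<in> cap \<delta> w" for w
      using cap_disjoint[OF V that(1) _ \<delta> that(2)] u by auto
    have "\<bar>?z \<bullet> w\<bar> * indicator (cap \<delta> w) y = (if w = u then \<bar>?z \<bullet> u\<bar> else 0)"
      if "w \<in> V - {v}" for w
    proof (cases "w = u")
      case False
      then have "y \<notin> cap \<delta> w" using uniq[of w] that by blast
      with False show ?thesis by simp
    qed (use u in simp)
    then have "\<phi> y = (\<Sum>w\<in>V - {v}. if w = u then \<bar>?z \<bullet> u\<bar> else 0)"
      unfolding \<phi>_def by (rule sum.cong[OF refl])
    then have \<phi>: "\<phi> y = \<bar>?z \<bullet> u\<bar>" using u(1) finite_V by simp
    have "sep V \<delta> a y = 1" "sep V \<delta> b y = 1"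
      using sep_distinct[OF v _ _ _ u(2)] u(1) ab by auto
    then have h: "h y = \<bar>a \<bullet> y\<bar> + \<bar>b \<bullet> y\<bar> + \<delta> * norm ?z" by (simp add: h_def)
    obtain s where s: "s = 1 \<or> s = - 1" "norm (s *\<^sub>R y - u) < \<delta>" by (rule cap_sign[OF u(2)])
    have "?z \<bullet> u = s * (a \<bullet> y) - s * (b \<bullet> y) - ?z \<bullet> (s *\<^sub>R y - u)"
      using s(1) by (auto simp: inner_diff_left inner_diff_right)
    then have "\<bar>?z \<bullet> u\<bar> \<le> \<bar>s * (a \<bullet> y)\<bar> + \<bar>s * (b \<bullet> y)\<bar> + \<bar>?z \<bullet> (s *\<^sub>R y - u)\<bar>" by linarith
    also have "\<bar>?z \<bullet> (s *\<^sub>R y - u)\<bar> \<le> norm ?z * norm (s *\<^sub>R y - u)" by (rule Cauchy_Schwarz_ineq2)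
    also have "\<dots> \<le> norm ?z * \<delta>" using s by (intro mult_left_mono) auto
    finally show ?thesis using s(1) by (auto simp: \<phi> h mult.commute)
  next
    case False
    then have "\<phi> y = 0" unfolding \<phi>_def by (intro sum.neutral) auto
    then show ?thesis using h0 by simp
  qed
  have "m * (\<Sum>u\<in>V - {v}. \<bar>?z \<bullet> u\<bar>) \<le> (\<Sum>u\<in>V - {v}. \<bar>?z \<bullet> u\<bar> * prob (cap \<delta> u))"
    unfolding sum_distrib_left using m by (intro sum_mono) (auto simp: mult.commute[of m] intro!: mult_left_mono)
  also have "\<dots> = (\<integral>y. \<phi> y \<partial>\<xi>)"
    unfolding \<phi>_def
    by (subst Bochner_Integration.integral_sum) (simp_all add: cap_integrable)
  also have "\<dots> \<le> (\<integral>y. h y \<partial>\<xi>)"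
  proof (rule integral_mono_AE')
    show "integrable \<xi> h"
      unfolding h_def using sep_inner_integrable[OF a(1)] sep_inner_integrable[OF b(1)] by simp
    show "AE y in \<xi>. \<phi> y \<le> h y" by (intro AE_I2 le norm_eq)
    show "AE y in \<xi>. 0 \<le> h y" by (intro AE_I2 h0)
  qed
  also have "\<dots> = leak a + leak b + \<delta> * norm ?z"
    unfolding h_def leak_def
    using sep_inner_integrable[OF a(1)] sep_inner_integrable[OF b(1)] by (simp add: prob_space)
  finally have "(\<Sum>u\<in>V - {v}. \<bar>?z \<bullet> u\<bar>) \<le> 1 / m * (leak a + leak b + \<delta> * norm ?z)"
    using m(1) by (simp add: field_simps)
  with norm_diff_le_sum_inner[OF V v a(1) b(1) a(2) b(2)]
  have "norm ?z \<le> 1 / m * (leak a + leak b + \<delta> * norm ?z) + \<delta> * norm ?z" by linarith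
  \<comment> \<open>The coefficient of \<open>norm ?z\<close> is now the quantity that the
    hypothesis keeps below \<open>1 / 2\<close>, so this term moves to the left side.\<close>
  also have "\<dots> = 1 / m * (leak a + leak b) + \<delta> * (1 / m + 1) * norm ?z" by (simp add: algebra_simps)
  also have "\<dots> \<le> 1 / m * (leak a + leak b) + 1 / 2 * norm ?z"
    using \<delta>m by (intro add_left_mono mult_right_mono) auto
  finally have "norm ?z \<le> 2 * (1 / m * (leak a + leak b))" by linarith
  then show ?thesis by simp
qed

text \<open>The power is split into exponents \<open>a - 1\<close> and 1. The first factor is small
  because points of one cap are, up to sign, within \<open>2 * \<delta>\<close>; the second is
  bounded by the leak.\<close>

lemma acute_angle_powr_le:
  assumes m: "0 < m" "\<And>u. u \<in> V \<Longrightarrow> m \<le> prob (cap \<delta> u)" and \<delta>m: "\<delta> * (1 / m + 1) \<le> 1 / 2"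
    and a: "1 \<le> a" and x: "v \<in> V" "x \<in> cap \<delta> v" "y \<in> cap \<delta> v"
  shows "acute_angle x y powr a \<le> (2 * \<delta>) powr (a - 1) * (2 / m * (leak x + leak y))"
proof -
  obtain s where s: "s = 1 \<or> s = - 1" "norm (s *\<^sub>R x - v) < \<delta>" by (rule cap_sign[OF x(2)])
  obtain t where t: "t = 1 \<or> t = - 1" "norm (t *\<^sub>R y - v) < \<delta>" by (rule cap_sign[OF x(3)])
  have n: "norm x = 1" "norm y = 1" using x by (auto simp: cap_def)
  have n': "norm (s *\<^sub>R x) = 1" "norm (t *\<^sub>R y) = 1" using s t n by auto
  let ?d = "norm (s *\<^sub>R x - t *\<^sub>R y)"
  have leak: "leak (s *\<^sub>R x) = leak x" "leak (t *\<^sub>R y) = leak y"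
    using s(1) t(1) leak_minus by auto
  have d: "?d \<le> 2 / m * (leak x + leak y)"
    using norm_diff_le_leak[OF x(1) n'(1) s(2) n'(2) t(2) m \<delta>m] by (simp add: leak)
  have "?d \<le> norm (s *\<^sub>R x - v) + norm (t *\<^sub>R y - v)"
    using norm_triangle_ineq4[of "s *\<^sub>R x - v" "t *\<^sub>R y - v"] by simp
  then have d2: "?d \<le> 2 * \<delta>" using s t by simp
  have sym: "acute_angle (- y) w = acute_angle y w" if "norm y = 1" "norm w = 1" for y w :: "real^'n"
    using acute_angle_minus[OF that(2,1)] by (simp add: acute_angle_def geodesic_dist_def inner_commute)
  have "acute_angle x y = acute_angle (s *\<^sub>R x) (t *\<^sub>R y)"
    using s(1) t(1) n by (auto simp: sym acute_angle_minus)
  also have "\<dots> \<le> ?d" by (rule acute_angle_le_norm_diff[OF n'])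
  finally have "acute_angle x y powr a \<le> ?d powr a"
    using a acute_angle_nonneg[OF n] by (intro powr_mono2) auto
  also have "\<dots> = ?d powr (a - 1) * ?d"
    by (cases "?d = 0") (auto simp: powr_diff)
  also have "\<dots> \<le> (2 * \<delta>) powr (a - 1) * ?d"
    using d2 a by (intro mult_right_mono powr_mono2) auto
  also have "\<dots> \<le> (2 * \<delta>) powr (a - 1) * (2 / m * (leak x + leak y))"
    using d by (intro mult_left_mono) auto
  finally show ?thesis .
qed

section \<open>Energy near the frame and on the frame\<close>

text \<open>The kernel is dominated by a function \<open>H\<close> whose integral is explicit. In it
  the gain contributes \<open>2 * K\<close> and the loss \<open>- 2 / pi\<close> times the
  integrated leak; \<open>small\<close> says that \<open>2 * K\<close> is at most
  \<open>1 / pi\<close>, so half of the loss remains.\<close>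

lemma energy_upper_bound:
  assumes m: "0 < m" "\<And>u. u \<in> V \<Longrightarrow> m \<le> prob (cap \<delta> u)" and \<delta>m: "\<delta> * (1 / m + 1) \<le> 1 / 2"
    and a: "1 \<le> a" "ereal a \<le> \<beta>" and small: "(2 * \<delta>) powr (a - 1) * (4 / m) \<le> 1 / pi"
  shows "2 * energy \<beta> \<xi> \<le> 1 - (\<Sum>v\<in>V. (prob (cap \<delta> v))\<^sup>2) - 1 / pi * (\<integral>x. leak x \<partial>\<xi>)"
proof -
  define K where "K = (2 * \<delta>) powr (a - 1) * (2 / m)"
  \<comment> \<open>Inside a cap \<open>sep\<close> vanishes and the leak term bounds the kernel.
    Between different caps \<open>sep\<close> is 1 and the linear bound on the angle takes
    over.\<close>
  define H where "H x y = K * (leak x + leak y) + sep V \<delta> x y - 2 / pi * (sep V \<delta> x y * \<bar>x \<bullet> y\<bar>)" for x y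
  let ?L = "\<integral>x. leak x \<partial>\<xi>"
  have K: "0 \<le> K" using m by (simp add: K_def)
  \<comment> \<open>Nonnegativity of the majorant allows the integrals to be compared below without
    showing that the kernel is integrable.\<close>
  have H0: "0 \<le> H x y" if "norm x = 1" "norm y = 1" for x y
  proof -
    have "0 \<le> K * (leak x + leak y)"
      using K leak_bounds(1)[OF that(1)] leak_bounds(1)[OF that(2)] by simp
    moreover have "2 / pi * (sep V \<delta> x y * \<bar>x \<bullet> y\<bar>) \<le> 1 * (sep V \<delta> x y * 1)"
      using abs_inner_le_1(1)[OF that] sep_bounds pi_ge_two
      by (intro mult_mono) auto
    ultimately show ?thesis by (simp add: H_def)
  qed
  have le: "kernel \<beta> x y \<le> H x y" if v: "v \<in> V" "x \<in> cap \<delta> v" and u: "u \<in> V" "y \<in> cap \<delta> u" for x y u v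
  proof -
    have n: "norm x = 1" "norm y = 1" using v u by (auto simp: cap_def)
    show ?thesis
    proof (cases "u = v")
      case True
      then have "sep V \<delta> x y = 0" using u v by (auto simp: sep_if)
      then have "H x y = (2 * \<delta>) powr (a - 1) * (2 / m * (leak x + leak y))"
        by (simp add: H_def K_def)
      then show ?thesis
        using kernel_le_powr[OF n a(2)] acute_angle_powr_le[OF m \<delta>m a(1) v] u True by fastforce
    next
      case False
      then have "sep V \<delta> x y = 1"
        using sep_distinct[OF v(1) u(1) _ v(2) u(2)] by auto
      then have "1 - 2 / pi * \<bar>x \<bullet> y\<bar> \<le> H x y"
        using K leak_bounds(1)[OF n(1)] leak_bounds(1)[OF n(2)] by (simp add: H_def)
      \<comment> \<open>Between different caps the exponent is lowered to 1, since only the linear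
        loss is needed there.\<close>
      moreover have "acute_angle x y powr a \<le> acute_angle x y powr 1"
        using a acute_angle_nonneg[OF n] acute_angle_le_1[OF n]
        using powr_mono'[of 1 a "acute_angle x y"] by simp
      ultimately show ?thesis
        using kernel_le_powr[OF n a(2)] acute_angle_le_one_minus_inner[OF n] acute_angle_nonneg[OF n]
        by simp
    qed
  qed
  have int: "integrable \<xi> (H x)" if "norm x = 1" for x
    unfolding H_def using leak_integrable sep_integrable[OF that] sep_inner_integrable[OF that] by auto
  have intH: "(\<integral>y. H x y \<partial>\<xi>) = K * (leak x + ?L) + (\<integral>y. sep V \<delta> x y \<partial>\<xi>) - 2 / pi * leak x"
    if "norm x = 1" for x
    unfolding H_def using leak_integrable sep_integrable[OF that] sep_inner_integrable[OF that]
    by (simp add: prob_space leak_def[symmetric])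
  have inner: "AE x in \<xi>. (\<integral>y. kernel \<beta> x y \<partial>\<xi>) \<le> (\<integral>y. H x y \<partial>\<xi>)"
    using covered AE_space
  proof eventually_elim
    case (elim x)
    then have x: "norm x = 1" by (simp add: norm_eq)
    show ?case
    proof (rule integral_mono_AE'[OF int[OF x]])
      show "AE y in \<xi>. kernel \<beta> x y \<le> H x y"
        using covered by eventually_elim (use elim le in blast)
      show "AE y in \<xi>. 0 \<le> H x y" using H0[OF x norm_eq] by (intro AE_I2)
    qed
  qed
  have intS: "integrable \<xi> (\<lambda>x. \<integral>y. sep V \<delta> x y \<partial>\<xi>)"
    unfolding integral_sep
    by (intro Bochner_Integration.integrable_diff Bochner_Integration.integrable_sum
      integrable_mult_left cap_integrable) simp
  have eqI: "integrable \<xi> (\<lambda>x. \<integral>y. H x y \<partial>\<xi>) \<longleftrightarrow>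
      integrable \<xi> (\<lambda>x. K * (leak x + ?L) + (\<integral>y. sep V \<delta> x y \<partial>\<xi>) - 2 / pi * leak x)"
    by (intro Bochner_Integration.integrable_cong) (auto simp: intH norm_eq)
  have "2 * energy \<beta> \<xi> = (\<integral>x. (\<integral>y. kernel \<beta> x y \<partial>\<xi>) \<partial>\<xi>)" by (simp add: energy_def)
  also have "\<dots> \<le> (\<integral>x. (\<integral>y. H x y \<partial>\<xi>) \<partial>\<xi>)"
  proof (rule integral_mono_AE'[OF _ inner])
    show "integrable \<xi> (\<lambda>x. \<integral>y. H x y \<partial>\<xi>)"
      unfolding eqI using intS leak_integrable by auto
    show "AE x in \<xi>. 0 \<le> (\<integral>y. H x y \<partial>\<xi>)"
      by (intro AE_I2 integral_nonneg_AE H0 norm_eq)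
  qed
  also have "\<dots> = (\<integral>x. K * (leak x + ?L) + (\<integral>y. sep V \<delta> x y \<partial>\<xi>) - 2 / pi * leak x \<partial>\<xi>)"
    by (intro Bochner_Integration.integral_cong) (auto simp: intH norm_eq)
  also have "\<dots> = K * (?L + ?L) + (\<integral>x. (\<integral>y. sep V \<delta> x y \<partial>\<xi>) \<partial>\<xi>) - 2 / pi * ?L"
    using intS leak_integrable by (simp add: prob_space)
  also have "\<dots> = 1 - (\<Sum>v\<in>V. (prob (cap \<delta> v))\<^sup>2) + (2 * K - 2 / pi) * ?L"
    by (simp add: double_integral_sep algebra_simps)
  also have "\<dots> \<le> 1 - (\<Sum>v\<in>V. (prob (cap \<delta> v))\<^sup>2) + (- 1 / pi) * ?L"
  proof (intro add_left_mono mult_right_mono)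
    have "2 * K \<le> 1 / pi" using small by (simp add: K_def mult.commute)
    then show "2 * K - 2 / pi \<le> - 1 / pi" by simp
    show "0 \<le> ?L" by (intro integral_nonneg_AE AE_I2 leak_bounds norm_eq)
  qed
  finally show ?thesis by simp
qed

text \<open>At points of the frame, up to sign, the kernel takes only the values 0 and 1 and agrees
  with \<open>sep\<close> for every exponent. Hence the value does not depend on
  \<open>\<beta>\<close>.\<close>

lemma energy_eq:
  assumes supp: "AE x in \<xi>. x \<in> V \<union> uminus ` V" and "0 < \<delta>"
  shows "2 * energy \<beta> \<xi> = 1 - (\<Sum>v\<in>V. (prob (cap \<delta> v))\<^sup>2)"
proof -
  have cap: "x \<in> cap \<delta> v \<longleftrightarrow> x = v \<or> x = - v" if x: "x \<in> V \<union> uminus ` V" "v \<in> V" for x v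
  proof -
    obtain u where u: "u \<in> V" "x = u \<or> x = - u" using x by auto
    have self: "w \<in> cap \<delta> w" "- w \<in> cap \<delta> w" if "w \<in> V" for w
      using V that \<open>0 < \<delta>\<close> by (auto simp: cap_def orthonormal_basis_def)
    have "x \<in> cap \<delta> v \<Longrightarrow> u = v"
      using cap_disjoint[OF V u(1) x(2) \<delta>] self[OF u(1)] u(2) by blast
    then show ?thesis using u(2) self[OF x(2)] by auto
  qed
  have eq: "kernel \<beta> x y = sep V \<delta> x y" if x: "x \<in> V \<union> uminus ` V" and y: "y \<in> V \<union> uminus ` V" for x y
  proof -
    obtain u where u: "u \<in> V" "x = u \<or> x = - u" using x by auto
    obtain w where w: "w \<in> V" "y = w \<or> y = - w" using y by auto
    have n: "norm x = 1" using u V by (auto simp: orthonormal_basis_def)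
    show ?thesis
    proof (cases "u = w")
      case True
      then have "y = x \<or> y = - x" using u w by auto
      then have "kernel \<beta> x y = 0" by (rule kernel_self_or_minus[OF n])
      then show ?thesis using cap[OF x u(1)] cap[OF y u(1)] u w True by (auto simp: sep_if)
    next
      case False
      then have "x \<bullet> y = 0" using u w orthonormal_basis_inner[OF V u(1) w(1)] by auto
      then have 1: "kernel \<beta> x y = 1" by (rule kernel_orthogonal)
      have "sep V \<delta> x y = 1"
      proof (rule ccontr)
        assume "sep V \<delta> x y \<noteq> 1"
        then obtain v where v: "v \<in> V" "x = v \<or> x = - v" "y = v \<or> y = - v"
          using cap[OF x] cap[OF y] by (auto simp: sep_if split: if_splits)
        then have "x \<bullet> y \<noteq> 0" using n by (auto simp: norm_eq_1)
        with \<open>x \<bullet> y = 0\<close> show False by simp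
      qed
      with 1 show ?thesis by simp
    qed
  qed
  have "2 * energy \<beta> \<xi> = (\<integral>x. (\<integral>y. kernel \<beta> x y \<partial>\<xi>) \<partial>\<xi>)" by (simp add: energy_def)
  also have "\<dots> = (\<integral>x. (\<integral>y. sep V \<delta> x y \<partial>\<xi>) \<partial>\<xi>)"
  proof (rule integral_cong_AE)
    show "AE x in \<xi>. (\<integral>y. kernel \<beta> x y \<partial>\<xi>) = (\<integral>y. sep V \<delta> x y \<partial>\<xi>)"
      using supp AE_space
    proof eventually_elim
      case (elim x)
      then have x: "norm x = 1" by (simp add: norm_eq)
      show ?case
      proof (rule integral_cong_AE)
        show "AE y in \<xi>. kernel \<beta> x y = sep V \<delta> x y"
          using supp by eventually_elim (use eq elim in blast)
      qed (rule section_measurable[OF x]; measurable)+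
    qed
  qed measurable
  finally show ?thesis by (simp only: double_integral_sep)
qed

end

section \<open>Rigidity when the leak vanishes\<close>

context clustered
begin

lemma AE_ex_in_cap:
  assumes "AE x in \<xi>. Q x" "0 < prob (cap \<delta> v)"
  obtains x where "x \<in> cap \<delta> v" "Q x"
proof -
  have "\<not> (AE x in \<xi>. x \<notin> cap \<delta> v)"
    using assms(2) by (simp add: prob_eq_0[symmetric])
  with assms(1) have "\<exists>x. x \<in> cap \<delta> v \<and> Q x"
    by (metis (mono_tags, lifting) eventually_mono)
  with that show thesis by blast
qed

text \<open>By \<open>norm_diff_le_leak\<close>, two points of zero leak near the same
  \<open>v\<close> coincide; this point is \<open>w v\<close>. The signs are kept in the last
  conclusion because the rotation must match points, not just antipodal pairs.\<close>

lemma rigid: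
  assumes m: "0 < m" "\<And>u. u \<in> V \<Longrightarrow> m \<le> prob (cap \<delta> u)" and \<delta>m: "\<delta> * (1 / m + 1) \<le> 1 / 2"
    and leak: "AE x in \<xi>. leak x = 0"
  obtains w where "\<And>v. v \<in> V \<Longrightarrow> norm (w v) = 1" "\<And>v. v \<in> V \<Longrightarrow> norm (w v - v) < \<delta>"
    "\<And>u v. u \<in> V \<Longrightarrow> v \<in> V \<Longrightarrow> u \<noteq> v \<Longrightarrow> w v \<bullet> w u = 0"
    "AE x in \<xi>. \<forall>v\<in>V. (norm (x - v) < \<delta> \<longrightarrow> x = w v) \<and> (norm (x + v) < \<delta> \<longrightarrow> x = - w v)"
proof -
  have pos: "0 < prob (cap \<delta> v)" if "v \<in> V" for v
    using m(1) m(2)[OF that] by linarith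
  have "\<exists>x. norm x = 1 \<and> norm (x - v) < \<delta> \<and> leak x = 0" if v: "v \<in> V" for v
  proof -
    obtain x where x: "x \<in> cap \<delta> v" "leak x = 0" by (rule AE_ex_in_cap[OF leak pos[OF v]])
    obtain s where s: "s = 1 \<or> s = - 1" "norm (s *\<^sub>R x - v) < \<delta>" by (rule cap_sign[OF x(1)])
    have "norm (s *\<^sub>R x) = 1" "leak (s *\<^sub>R x) = 0"
      using s(1) x leak_minus[of x] by (auto simp: cap_def)
    with s(2) show ?thesis by blast
  qed
  then obtain w where w: "\<And>v. v \<in> V \<Longrightarrow> norm (w v) = 1 \<and> norm (w v - v) < \<delta> \<and> leak (w v) = 0"
    by metis
  have uniq: "x = w v" if "v \<in> V" "norm x = 1" "norm (x - v) < \<delta>" "leak x = 0" for x v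
    using norm_diff_le_leak[OF that(1-3) _ _ m \<delta>m, of "w v"] w[OF that(1)] that(4) by simp
  have uniq': "x = - w v" if "v \<in> V" "norm x = 1" "norm (x + v) < \<delta>" "leak x = 0" for x v
  proof -
    have "- x - v = - (x + v)" by simp
    then have "norm (- x - v) < \<delta>" using that(3) by (metis norm_minus_cancel)
    then have "- x = w v" using uniq[OF that(1), of "- x"] that leak_minus[of x] by simp
    then show ?thesis by (metis minus_minus)
  qed
  have AE: "AE x in \<xi>. \<forall>v\<in>V. (norm (x - v) < \<delta> \<longrightarrow> x = w v) \<and> (norm (x + v) < \<delta> \<longrightarrow> x = - w v)"
    using leak AE_space by eventually_elim (use uniq uniq' norm_eq in blast)
  have orth: "w v \<bullet> w u = 0" if uv: "u \<in> V" "v \<in> V" "u \<noteq> v" for u v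
  proof -
    have wv: "norm (w v) = 1" "w v \<in> cap \<delta> v" "leak (w v) = 0"
      using w[OF uv(2)] by (auto simp: cap_def)
    \<comment> \<open>The leak at \<open>w v\<close> is the integral of a nonnegative function and
      is zero. Any typical point of the cap of \<open>u\<close> then witnesses the
      orthogonality.\<close>
    have "AE y in \<xi>. sep V \<delta> (w v) y * \<bar>w v \<bullet> y\<bar> = 0"
      using wv(3) unfolding leak_def
      by (subst (asm) integral_nonneg_eq_0_iff_AE[OF sep_inner_integrable[OF wv(1)]])
        (use sep_inner_bounds(1)[OF wv(1) norm_eq] in auto)
    with AE have "AE y in \<xi>. sep V \<delta> (w v) y * \<bar>w v \<bullet> y\<bar> = 0 \<and>
        (norm (y - u) < \<delta> \<longrightarrow> y = w u) \<and> (norm (y + u) < \<delta> \<longrightarrow> y = - w u)"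
      by eventually_elim (use uv in blast)
    then obtain y where y: "y \<in> cap \<delta> u" "sep V \<delta> (w v) y * \<bar>w v \<bullet> y\<bar> = 0 \<and>
        (norm (y - u) < \<delta> \<longrightarrow> y = w u) \<and> (norm (y + u) < \<delta> \<longrightarrow> y = - w u)"
      by (rule AE_ex_in_cap[OF _ pos[OF uv(1)]])
    have "sep V \<delta> (w v) y = 1"
      by (rule sep_distinct[OF uv(2,1) uv(3)[symmetric] wv(2) y(1)])
    then have "w v \<bullet> y = 0" using y(2) by simp
    moreover have "y = w u \<or> y = - w u" using y by (auto simp: cap_def)
    ultimately show ?thesis by auto
  qed
  show thesis using w orth AE by (intro that[of w]) auto
qed

end

text \<open>The linear map sending each \<open>v\<close> to \<open>w v\<close> preserves inner
  products. It moves \<open>x\<close> by at most \<open>CARD('n) * \<delta> * norm x\<close>, which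
  is too little for the eigenvalue -1, so its determinant is 1.\<close>

lemma orthonormal_frame_rotation:
  fixes V :: "(real^'n) set"
  assumes V: "orthonormal_basis V"
    and w: "\<And>v. v \<in> V \<Longrightarrow> norm (w v) = 1" "\<And>v. v \<in> V \<Longrightarrow> norm (w v - v) < \<delta>"
    and orth: "\<And>u v. u \<in> V \<Longrightarrow> v \<in> V \<Longrightarrow> u \<noteq> v \<Longrightarrow> w v \<bullet> w u = 0"
    and \<delta>: "real CARD('n) * \<delta> < 2"
  obtains M where "rotation_matrix M" "\<And>v. v \<in> V \<Longrightarrow> M *v v = w v"
proof -
  define f where "f x = (\<Sum>v\<in>V. (x \<bullet> v) *\<^sub>R w v)" for x
  have fin: "finite V" and card: "card V = CARD('n)"
    using orthonormal_basis_finite[OF V] by auto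
  have wf: "w v \<bullet> f x = x \<bullet> v" if "v \<in> V" for v x
  proof -
    have "(x \<bullet> u) * (w v \<bullet> w u) = (if u = v then x \<bullet> v else 0)" if u: "u \<in> V" for u
      using orth[OF u \<open>v \<in> V\<close>] w(1)[OF \<open>v \<in> V\<close>] by (cases "u = v") (auto simp: norm_eq_1)
    then have "w v \<bullet> f x = (\<Sum>u\<in>V. if u = v then x \<bullet> v else 0)"
      unfolding f_def inner_sum_right inner_scaleR_right by (rule sum.cong[OF refl])
    then show ?thesis using that fin by simp
  qed
  have lin: "linear f"
    unfolding f_def by (intro linearI)
      (simp_all add: inner_add_left scaleR_add_left sum.distrib scaleR_sum_right)
  have "f x \<bullet> f y = x \<bullet> y" for x y
  proof -
    have "f x \<bullet> f y = (\<Sum>v\<in>V. (x \<bullet> v) * (w v \<bullet> f y))"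
      by (subst f_def) (simp add: inner_sum_left)
    also have "\<dots> = (\<Sum>v\<in>V. (x \<bullet> v) * (y \<bullet> v))"
      by (intro sum.cong refl) (simp only: wf)
    also have "\<dots> = (\<Sum>v\<in>V. (x \<bullet> v) *\<^sub>R v) \<bullet> y"
      by (simp add: inner_sum_left inner_commute[of y])
    finally show ?thesis by (simp add: orthonormal_basis_expansion[OF V])
  qed
  then have "orthogonal_transformation f"
    using lin by (simp add: orthogonal_transformation_def)
  then have orthM: "orthogonal_matrix (matrix f)" by (simp add: orthogonal_transformation_matrix)
  have Mf: "matrix f *v x = f x" for x by (rule matrix_works[OF lin[folded linear_matrix_vector_mul_eq]])
  have near: "norm (matrix f *v x - x) < 2 * norm x" if "x \<noteq> 0" for x
  proof -
    have "f x - x = f x - (\<Sum>v\<in>V. (x \<bullet> v) *\<^sub>R v)" by (simp only: orthonormal_basis_expansion[OF V])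
    also have "\<dots> = (\<Sum>v\<in>V. (x \<bullet> v) *\<^sub>R (w v - v))"
      by (simp add: f_def sum_subtractf scaleR_diff_right)
    also have "norm \<dots> \<le> (\<Sum>v\<in>V. norm x * \<delta>)"
    proof (rule sum_norm_le)
      fix v assume v: "v \<in> V"
      have "\<bar>x \<bullet> v\<bar> \<le> norm x * norm v" by (rule Cauchy_Schwarz_ineq2)
      also have "norm v = 1" using V v by (simp add: orthonormal_basis_def)
      finally show "norm ((x \<bullet> v) *\<^sub>R (w v - v)) \<le> norm x * \<delta>"
        using w(2)[OF v] by (simp add: mult_mono)
    qed
    also have "\<dots> = (real CARD('n) * \<delta>) * norm x" by (simp add: card)
    also have "\<dots> < 2 * norm x" using \<delta> that by (intro mult_strict_right_mono) auto
    finally show ?thesis by (simp add: Mf)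
  qed
  have "f v = w v" if v: "v \<in> V" for v
  proof -
    have "(v \<bullet> u) *\<^sub>R w u = (if u = v then w v else 0)" if "u \<in> V" for u
      using orthonormal_basis_inner[OF V v that] by auto
    then have "f v = (\<Sum>u\<in>V. if u = v then w v else 0)"
      unfolding f_def by (rule sum.cong[OF refl])
    then show ?thesis using v fin by simp
  qed
  then show thesis using rotation_matrix_if_near_id[OF orthM near] Mf by (intro that[of "matrix f"]) auto
qed

section \<open>Couplings at small uniform distance\<close>

text \<open>Makes \<open>spt_smallest_full\<close> applicable to couplings, whose sigma-algebra is
  given as a product. The identity is shown to be measurable in both directions.\<close>

lemma sets_sphere_borel_pair:
  "sets (sphere_borel \<Otimes>\<^sub>M sphere_borel :: ((real^'n) \<times> (real^'n)) measure) =
    sets (restrict_space borel (sphere 0 1 \<times> sphere 0 1))" (is "sets ?P = sets ?R")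
proof -
  have sp: "space ?P = sphere 0 1 \<times> sphere 0 1" "space ?R = sphere 0 1 \<times> sphere 0 1"
    by (auto simp: space_pair_measure sphere_borel_def space_restrict_space)
  have id [measurable]: "(\<lambda>x. x) \<in> borel_measurable (sphere_borel :: (real^'n) measure)"
    unfolding sphere_borel_def by (rule measurable_restrict_space1) simp
  have "(\<lambda>p. (fst p, snd p)) \<in> borel_measurable ?P"
    unfolding borel_prod[symmetric] by measurable
  then have PR: "(\<lambda>p. p) \<in> measurable ?P ?R"
    by (intro measurable_restrict_space2) (auto simp: sp)
  have "(\<lambda>p. fst p) \<in> measurable ?R sphere_borel" "(\<lambda>p. snd p) \<in> measurable ?R sphere_borel"
    unfolding sphere_borel_def
    by (rule measurable_restrict_space3; force intro: borel_measurable_continuous_onI continuous_intros)+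
  then have "(\<lambda>p. (fst p, snd p)) \<in> measurable ?R ?P" by (rule measurable_Pair)
  then have RP: "(\<lambda>p. p) \<in> measurable ?R ?P" by simp
  show ?thesis
  proof (intro set_eqI iffI)
    fix A
    show "A \<in> sets ?R" if "A \<in> sets ?P"
      using measurable_sets[OF RP that] sets.sets_into_space[OF that]
      by (simp add: sp Int_absorb2 vimage_def)
    show "A \<in> sets ?P" if "A \<in> sets ?R"
      using measurable_sets[OF PR that] sets.sets_into_space[OF that]
      by (simp add: sp Int_absorb2 vimage_def)
  qed
qed

text \<open>Shows that the infimum in \<open>d_infty\<close> runs over a nonempty set, so that a
  strict upper bound on it yields an actual coupling.\<close>

lemma pair_measure_in_couplings:
  assumes "\<mu> \<in> sphere_prob" "\<nu> \<in> sphere_prob"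
  shows "\<mu> \<Otimes>\<^sub>M \<nu> \<in> couplings \<mu> \<nu>"
proof -
  have s: "sets \<mu> = sets sphere_borel" "sets \<nu> = sets sphere_borel" and
    p: "prob_space \<mu>" "prob_space \<nu>"
    using assms by (auto simp: sphere_prob_def)
  interpret M: prob_space \<mu> by (rule p)
  interpret N: prob_space \<nu> by (rule p)
  interpret P: pair_prob_space \<mu> \<nu> ..
  have "distr (\<mu> \<Otimes>\<^sub>M \<nu>) \<nu> snd = \<nu>"
  proof (rule measure_eqI)
    fix A assume "A \<in> sets (distr (\<mu> \<Otimes>\<^sub>M \<nu>) \<nu> snd)"
    then have A: "A \<in> sets \<nu>" by simp
    have "snd -` A \<inter> space (\<mu> \<Otimes>\<^sub>M \<nu>) = space \<mu> \<times> A"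
      using sets.sets_into_space[OF A] by (auto simp: space_pair_measure)
    then show "emeasure (distr (\<mu> \<Otimes>\<^sub>M \<nu>) \<nu> snd) A = emeasure \<nu> A"
      using A by (simp add: emeasure_distr N.emeasure_pair_measure_Times M.emeasure_space_1)
  qed simp
  moreover have "distr (\<mu> \<Otimes>\<^sub>M \<nu>) \<mu> fst = \<mu>" by (rule N.distr_pair_fst)
  moreover have "distr (\<mu> \<Otimes>\<^sub>M \<nu>) sphere_borel fst = distr (\<mu> \<Otimes>\<^sub>M \<nu>) \<mu> fst"
    "distr (\<mu> \<Otimes>\<^sub>M \<nu>) sphere_borel snd = distr (\<mu> \<Otimes>\<^sub>M \<nu>) \<nu> snd"
    using s by (auto intro!: distr_cong)
  ultimately show ?thesis
    using sets_pair_measure_cong[OF s] P.prob_space_axioms by (simp add: couplings_def)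
qed

text \<open>Some coupling has its supremum below \<open>r\<close>, and its support carries full
  measure, so the bound on the support holds almost everywhere.\<close>

lemma d_infty_lessE:
  fixes \<mu> \<nu> :: "(real^'n) measure"
  assumes "\<mu> \<in> sphere_prob" "\<nu> \<in> sphere_prob" "d_infty \<mu> \<nu> < r"
  obtains \<gamma> where "\<gamma> \<in> couplings \<mu> \<nu>" "AE p in \<gamma>. geodesic_dist (fst p) (snd p) < r"
proof -
  have "couplings \<mu> \<nu> \<noteq> {}" using pair_measure_in_couplings[OF assms(1,2)] by blast
  then obtain \<gamma> where \<gamma>: "\<gamma> \<in> couplings \<mu> \<nu>" and sup: "(SUP (x, y)\<in>spt \<gamma>. geodesic_dist x y) < r"
    using cInf_lessD[of "(\<lambda>\<gamma>. SUP (x, y)\<in>spt \<gamma>. geodesic_dist x y) ` couplings \<mu> \<nu>" r] assms(3)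
    by (auto simp: d_infty_def)
  have p: "prob_space \<gamma>" and s: "sets \<gamma> = sets (sphere_borel \<Otimes>\<^sub>M sphere_borel)"
    using \<gamma> by (auto simp: couplings_def)
  interpret prob_space \<gamma> by (rule p)
  have sp: "space \<gamma> = sphere 0 1 \<times> sphere 0 1"
    using sets_eq_imp_space_eq[OF s] by (simp add: space_pair_measure sphere_borel_def space_restrict_space)
  have cl: "closed (space \<gamma>)" unfolding sp by (intro closed_Times) auto
  have se: "sets \<gamma> = sets (restrict_space borel (space \<gamma>))"
    unfolding sp s by (rule sets_sphere_borel_pair)
  note spt = spt_smallest_full[OF finite_measure_axioms cl se]
  have "prob (spt \<gamma>) = 1" using spt(3) by (simp add: measure_def emeasure_space_1)
  then have "AE p in \<gamma>. p \<in> spt \<gamma>" by (rule AE_prob_1)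
  moreover have le: "geodesic_dist (fst q) (snd q) < r" if q: "q \<in> spt \<gamma>" for q
  proof -
    \<comment> \<open>A real supremum bounds the values only over a bounded set; here
      \<open>pi\<close> is a bound.\<close>
    have "bdd_above ((\<lambda>(x, y). geodesic_dist x y) ` spt \<gamma>)"
    proof (rule bdd_aboveI[of _ pi])
      fix t assume "t \<in> (\<lambda>(x, y). geodesic_dist x y) ` spt \<gamma>"
      then obtain x y where xy: "(x, y) \<in> spt \<gamma>" "t = geodesic_dist x y" by auto
      then have "norm x = 1" "norm y = 1" using spt(2) by (auto simp: sp)
      then show "t \<le> pi" using geodesic_dist_bounds(2) xy(2) by simp
    qed
    then have "(\<lambda>(x, y). geodesic_dist x y) q \<le> (SUP (x, y)\<in>spt \<gamma>. geodesic_dist x y)"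
      using q by (intro cSUP_upper)
    with sup show ?thesis by (simp add: case_prod_beta)
  qed
  ultimately have "AE p in \<gamma>. geodesic_dist (fst p) (snd p) < r"
    by (rule eventually_mono)
  with \<gamma> that show thesis by blast
qed

text \<open>A closed set of full measure that misses the atom would, together with it, exceed the
  total mass.\<close>

lemma atom_in_spt:
  assumes "finite_measure \<mu>" "{z} \<in> sets \<mu>" "0 < measure \<mu> {z}"
  shows "z \<in> spt \<mu>"
  unfolding spt_def
proof (rule InterI, rule ccontr)
  interpret finite_measure \<mu> by fact
  fix C assume C: "C \<in> {C. closed C \<and> C \<subseteq> space \<mu> \<and> emeasure \<mu> C = emeasure \<mu> (space \<mu>)}" and z: "z \<notin> C"
  have "measure \<mu> (space \<mu>) > 0"
    using assms(3) bounded_measure[of "{z}"] by linarith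
  \<comment> \<open>A set outside the sigma-algebra has \<open>emeasure\<close> 0 by convention,
    whereas \<open>C\<close> carries the positive total mass.\<close>
  then have "C \<in> sets \<mu>"
    using C emeasure_notin_sets[of C \<mu>] by (force simp: measure_def)
  then have "measure \<mu> (C \<union> {z}) = measure \<mu> C + measure \<mu> {z}"
    using assms(2) z by (intro finite_measure_Union) auto
  moreover have "measure \<mu> C = measure \<mu> (space \<mu>)" using C by (simp add: measure_def)
  ultimately show False using bounded_measure[of "C \<union> {z}"] assms(3) by linarith
qed

section \<open>Choice of the radius and comparison of the energies\<close>

text \<open>The conditions serve, in order, disjoint caps and determinant 1, absorption in
  \<open>norm_diff_le_leak\<close>, and the dominance of loss over gain. The last one can be met
  because \<open>a - 1\<close> is positive.\<close>

lemma exists_radius: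
  fixes m a n :: real
  assumes "0 < m" "1 < a" "1 \<le> n"
  obtains \<delta> :: real where "0 < \<delta>" "n * \<delta> \<le> 1 / 2" "\<delta> * (1 / m + 1) \<le> 1 / 2"
    "(2 * \<delta>) powr (a - 1) * (4 / m) \<le> 1 / pi"
proof -
  \<comment> \<open>Chosen such that \<open>(2 * e) powr (a - 1)\<close> is exactly
    \<open>m / (4 * pi)\<close>.\<close>
  define e where "e = (m / (4 * pi)) powr (1 / (a - 1)) / 2"
  define \<delta> where "\<delta> = min (1 / (2 * n)) (min (1 / (2 * (1 / m + 1))) e)"
  have c: "0 < 1 / m + 1" using assms by (simp add: add_pos_pos)
  have e: "0 < e" using assms by (simp add: e_def)
  have pos: "0 < \<delta>" using assms c e by (simp add: \<delta>_def)
  have "n * \<delta> \<le> n * (1 / (2 * n))" using assms by (intro mult_left_mono) (auto simp: \<delta>_def)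
  then have 1: "n * \<delta> \<le> 1 / 2" using assms by simp
  have "\<delta> * (1 / m + 1) \<le> 1 / (2 * (1 / m + 1)) * (1 / m + 1)"
    using c by (intro mult_right_mono) (auto simp: \<delta>_def)
  also have "\<dots> = 1 / 2" using c by simp
  finally have 2: "\<delta> * (1 / m + 1) \<le> 1 / 2" .
  have "(2 * \<delta>) powr (a - 1) \<le> (2 * e) powr (a - 1)"
    using pos assms by (intro powr_mono2) (auto simp: \<delta>_def)
  also have "\<dots> = m / (4 * pi)" using assms by (simp add: e_def powr_powr)
  finally have "(2 * \<delta>) powr (a - 1) * (4 / m) \<le> m / (4 * pi) * (4 / m)"
    using assms by (intro mult_right_mono) auto
  also have "\<dots> = 1 / pi" using assms by simp
  finally show thesis using that pos 1 2 by blast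
qed

lemma rotation_matrix_sphere_measurable:
  assumes "rotation_matrix M"
  shows "(*v) M \<in> measurable sphere_borel (sphere_borel :: (real^'n) measure)"
proof -
  have "orthogonal_transformation ((*v) M)"
    using assms by (simp add: rotation_matrix_def orthogonal_transformation_matrix)
  then have "norm (M *v x) = norm x" for x by (rule orthogonal_transformation_norm)
  then show ?thesis unfolding sphere_borel_def
    by (intro measurable_restrict_space3 borel_measurable_continuous_onI
      matrix_vector_mult_linear_continuous_on) auto
qed

text \<open>The coupling gives both measures the same cap masses, so \<open>energy_eq\<close> and
  \<open>energy_upper_bound\<close> differ only by the integrated leak. If that is zero, rigidity
  turns the coupling into the graph of a rotation.\<close>

lemma near_simplex_measure:
  fixes \<xi> \<xi>' :: "(real^'n) measure"
  assumes V: "orthonormal_basis V"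
    and \<xi>: "\<xi> \<in> sphere_prob" and \<xi>': "\<xi>' \<in> sphere_prob"
    and supp: "measure \<xi>' (V \<union> uminus ` V) = 1"
    and m: "0 < m" "\<And>v. v \<in> V \<Longrightarrow> m \<le> measure \<xi>' {v, - v}"
    and d: "d_infty \<xi> \<xi>' < \<delta>"
    and \<delta>: "0 < \<delta>" "real CARD('n) * \<delta> \<le> 1 / 2" "\<delta> * (1 / m + 1) \<le> 1 / 2"
      "(2 * \<delta>) powr (a - 1) * (4 / m) \<le> 1 / pi"
    and a: "1 < a" "ereal a \<le> \<beta>"
  shows "energy \<beta> \<xi> \<le> energy \<beta> \<xi>'" "energy \<beta> \<xi> < energy \<beta> \<xi>' \<or> is_rotation_of \<xi> \<xi>'"
proof -
  have "1 * \<delta> \<le> real CARD('n) * \<delta>" using \<delta>(1) by (intro mult_right_mono) (auto simp: Suc_le_eq)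
  then have \<delta>2: "\<delta> \<le> 1 / 2" using \<delta>(2) by linarith
  interpret X: sphere_prob_space \<xi>
    using \<xi> by (simp add: sphere_prob_def sphere_prob_space_def sphere_prob_space_axioms_def)
  interpret Y: sphere_prob_space \<xi>'
    using \<xi>' by (simp add: sphere_prob_def sphere_prob_space_def sphere_prob_space_axioms_def)
  obtain \<gamma> where \<gamma>: "\<gamma> \<in> couplings \<xi> \<xi>'" "AE p in \<gamma>. geodesic_dist (fst p) (snd p) < \<delta>"
    by (rule d_infty_lessE[OF \<xi> \<xi>' d])
  have s: "sets \<gamma> = sets (sphere_borel \<Otimes>\<^sub>M sphere_borel)"
    and fst_eq: "\<xi> = distr \<gamma> sphere_borel fst" and snd_eq: "\<xi>' = distr \<gamma> sphere_borel snd"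
    using \<gamma>(1) by (auto simp: couplings_def)
  have fst_meas: "fst \<in> measurable \<gamma> sphere_borel" and snd_meas: "snd \<in> measurable \<gamma> sphere_borel"
    by (simp_all add: measurable_cong_sets[OF s refl])
  have sp: "space \<gamma> = sphere 0 1 \<times> sphere 0 1"
    using sets_eq_imp_space_eq[OF s] by (simp add: space_pair_measure sphere_borel_def space_restrict_space)
  have suppY: "AE y in \<xi>'. y \<in> V \<union> uminus ` V" by (rule Y.AE_prob_1[OF supp])
  have supp\<gamma>: "AE p in \<gamma>. snd p \<in> V \<union> uminus ` V"
    using suppY unfolding snd_eq by (rule AE_distrD[OF snd_meas])
  \<comment> \<open>The sign is recorded as well; it is needed to identify the rotation at the
    end.\<close>
  have near: "AE p in \<gamma>. \<exists>v\<in>V. fst p \<in> cap \<delta> v \<and> snd p \<in> cap \<delta> v \<and>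
      (snd p = v \<and> norm (fst p - v) < \<delta> \<or> snd p = - v \<and> norm (fst p + v) < \<delta>)"
    using supp\<gamma> \<gamma>(2) AE_space
  proof eventually_elim
    case (elim p)
    have n: "norm (fst p) = 1" "norm (snd p) = 1" using elim(3) by (auto simp: sp)
    then have "norm (fst p - snd p) < \<delta>"
      using norm_diff_le_geodesic_dist[OF n] elim(2) by linarith
    moreover obtain v where "v \<in> V" "snd p = v \<or> snd p = - v" using elim(1) by auto
    ultimately show ?case using n \<delta>(1) by (intro bexI[of _ v]) (auto simp: cap_def)
  qed
  have meas: "{x \<in> space sphere_borel. \<exists>v\<in>V. x \<in> cap \<delta> v} \<in> sets sphere_borel"
  proof -
    have "{x \<in> space sphere_borel. \<exists>v\<in>V. x \<in> cap \<delta> v} = (\<Union>v\<in>V. cap \<delta> v)"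
      by (auto simp: sphere_borel_def space_restrict_space cap_def)
    then show ?thesis
      using X.cap_sets orthonormal_basis_finite(1)[OF V] by (auto simp: X.sets_eq)
  qed
  have covX: "AE x in \<xi>. \<exists>v\<in>V. x \<in> cap \<delta> v"
    unfolding fst_eq AE_distr_iff[OF fst_meas meas]
    using near by eventually_elim blast
  have covY: "AE x in \<xi>'. \<exists>v\<in>V. x \<in> cap \<delta> v"
    unfolding snd_eq AE_distr_iff[OF snd_meas meas]
    using near by eventually_elim blast
  interpret X: clustered \<xi> V \<delta> using V \<delta>2 covX by unfold_locales
  interpret Y: clustered \<xi>' V \<delta> using V \<delta>2 covY by unfold_locales
  have prob_eq: "X.prob (cap \<delta> v) = Y.prob (cap \<delta> v)" if v: "v \<in> V" for v
  proof -
    have c: "cap \<delta> v \<in> sets sphere_borel" using X.cap_sets by (simp add: X.sets_eq)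
    \<comment> \<open>Almost every pair has both coordinates in one common cap, and the caps are
      disjoint, so the two events agree up to a null set.\<close>
    have "AE p in \<gamma>. p \<in> fst -` cap \<delta> v \<inter> space \<gamma> \<longleftrightarrow> p \<in> snd -` cap \<delta> v \<inter> space \<gamma>"
      using near
    proof eventually_elim
      case (elim p)
      then obtain u where u: "u \<in> V" "fst p \<in> cap \<delta> u" "snd p \<in> cap \<delta> u" by blast
      then show ?case using cap_disjoint[OF V u(1) v \<delta>2] by blast
    qed
    then have "measure \<gamma> (fst -` cap \<delta> v \<inter> space \<gamma>) = measure \<gamma> (snd -` cap \<delta> v \<inter> space \<gamma>)"
      by (rule measure_eq_AE) (rule measurable_sets[OF fst_meas c] measurable_sets[OF snd_meas c])+
    then show ?thesis
      using measure_distr[OF fst_meas c] measure_distr[OF snd_meas c] by (simp add: fst_eq[symmetric] snd_eq[symmetric])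
  qed
  have mY: "m \<le> Y.prob (cap \<delta> v)" if v: "v \<in> V" for v
  proof -
    have "{v, - v} \<subseteq> cap \<delta> v" using V v \<delta>(1) by (auto simp: cap_def orthonormal_basis_def)
    then show ?thesis
      using m(2)[OF v] Y.finite_measure_mono[OF _ Y.cap_sets] by (meson order_trans)
  qed
  then have mX: "m \<le> X.prob (cap \<delta> v)" if "v \<in> V" for v
    using that by (simp add: prob_eq)
  have EY: "2 * energy \<beta> \<xi>' = 1 - (\<Sum>v\<in>V. (X.prob (cap \<delta> v))\<^sup>2)"
    using Y.energy_eq[OF suppY \<delta>(1)] by (simp add: prob_eq)
  have EX: "2 * energy \<beta> \<xi> \<le> 1 - (\<Sum>v\<in>V. (X.prob (cap \<delta> v))\<^sup>2) - 1 / pi * (\<integral>x. X.leak x \<partial>\<xi>)"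
    using a by (intro X.energy_upper_bound[OF m(1) mX \<delta>(3) _ a(2) \<delta>(4)]) auto
  have leak0: "AE x in \<xi>. 0 \<le> X.leak x" by (intro AE_I2 X.leak_bounds X.norm_eq)
  then have L: "0 \<le> (\<integral>x. X.leak x \<partial>\<xi>)" by (rule integral_nonneg_AE)
  then have "0 \<le> 1 / pi * (\<integral>x. X.leak x \<partial>\<xi>)" by simp
  with EX EY show "energy \<beta> \<xi> \<le> energy \<beta> \<xi>'" by linarith
  show "energy \<beta> \<xi> < energy \<beta> \<xi>' \<or> is_rotation_of \<xi> \<xi>'"
  proof (cases "(\<integral>x. X.leak x \<partial>\<xi>) = 0")
    case False
    with L have "0 < 1 / pi * (\<integral>x. X.leak x \<partial>\<xi>)" by simp
    with EX EY show ?thesis by linarith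
  next
    case True
    then have "AE x in \<xi>. X.leak x = 0"
      using integral_nonneg_eq_0_iff_AE[OF X.leak_integrable leak0] by simp
    then obtain w where w: "\<And>v. v \<in> V \<Longrightarrow> norm (w v) = 1" "\<And>v. v \<in> V \<Longrightarrow> norm (w v - v) < \<delta>"
      "\<And>u v. u \<in> V \<Longrightarrow> v \<in> V \<Longrightarrow> u \<noteq> v \<Longrightarrow> w v \<bullet> w u = 0"
      and AEw: "AE x in \<xi>. \<forall>v\<in>V. (norm (x - v) < \<delta> \<longrightarrow> x = w v) \<and> (norm (x + v) < \<delta> \<longrightarrow> x = - w v)"
      using X.rigid[OF m(1) mX \<delta>(3)] by blast
    have "real CARD('n) * \<delta> < 2" using \<delta>(2) by linarith
    then obtain M where M: "rotation_matrix M" "\<And>v. v \<in> V \<Longrightarrow> M *v v = w v"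
      using orthonormal_frame_rotation[OF V w] by blast
    note Mm = rotation_matrix_sphere_measurable[OF M(1)]
    have "AE p in \<gamma>. \<forall>v\<in>V. (norm (fst p - v) < \<delta> \<longrightarrow> fst p = w v) \<and> (norm (fst p + v) < \<delta> \<longrightarrow> fst p = - w v)"
      using AEw unfolding fst_eq by (rule AE_distrD[OF fst_meas])
    \<comment> \<open>Under the coupling the first coordinate is now the rotated second one, so the
      left marginal is the rotation of the right one.\<close>
    with near have eq: "AE p in \<gamma>. fst p = ((*v) M \<circ> snd) p"
    proof eventually_elim
      case (elim p)
      then obtain v where "v \<in> V" "snd p = v \<and> fst p = w v \<or> snd p = - v \<and> fst p = - w v" by blast
      then show ?case using M(2)[of v] linear_neg[OF matrix_vector_mul_linear[of M]] by auto
    qed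
    have "\<xi> = distr \<gamma> sphere_borel ((*v) M \<circ> snd)"
      using distr_cong_AE[OF refl refl eq fst_meas measurable_comp[OF snd_meas Mm]] by (simp add: fst_eq[symmetric])
    also have "\<dots> = distr \<xi>' sphere_borel ((*v) M)"
      using distr_distr[OF Mm snd_meas] by (simp add: snd_eq[symmetric])
    finally show ?thesis using M(1) by (auto simp: is_rotation_of_def)
  qed
qed

theorem theorem2p4:
  fixes \<alpha> :: ereal and m :: real and d :: nat
  assumes "1 < \<alpha>" and "\<alpha> < \<infinity>" and "m > 0" and "d \<ge> 1" and "CARD('n::finite) = d + 1"
  shows "\<exists>r::real. r > 0 \<and>
    (\<forall>\<beta> \<ge> \<alpha>. \<forall>\<xi> \<in> sphere_prob. \<forall>\<xi>' \<in> (sphere_prob :: (real^'n) measure set).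
       d_infty \<xi> \<xi>' < r \<longrightarrow>
       \<xi>' \<in> sphere_prob_simplex \<longrightarrow>
       (\<forall>z \<in> spt \<xi>'. measure \<xi>' {z, - z} \<ge> m) \<longrightarrow>
       energy \<beta> \<xi> \<le> energy \<beta> \<xi>' \<and>
       (\<not> is_rotation_of \<xi> \<xi>' \<longrightarrow> energy \<beta> \<xi> < energy \<beta> \<xi>'))"
proof -
  obtain a where a: "\<alpha> = ereal a" "1 < a" using assms(1,2) by (cases \<alpha>) auto
  have "1 \<le> real CARD('n)" using assms(5) by simp
  then obtain \<delta> where \<delta>: "0 < \<delta>" "real CARD('n) * \<delta> \<le> 1 / 2" "\<delta> * (1 / m + 1) \<le> 1 / 2"
    "(2 * \<delta>) powr (a - 1) * (4 / m) \<le> 1 / pi"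
    using exists_radius[OF \<open>m > 0\<close> a(2)] by metis
  show ?thesis
  proof (intro exI[of _ \<delta>] conjI allI ballI impI \<delta>(1))
    fix \<beta> and \<xi> \<xi>' :: "(real^'n) measure"
    assume \<beta>: "\<alpha> \<le> \<beta>" and \<xi>: "\<xi> \<in> sphere_prob" "\<xi>' \<in> sphere_prob" "d_infty \<xi> \<xi>' < \<delta>"
      and simplex: "\<xi>' \<in> sphere_prob_simplex" and m: "\<forall>z \<in> spt \<xi>'. measure \<xi>' {z, - z} \<ge> m"
    obtain V where V: "orthonormal_basis V" "measure \<xi>' (V \<union> uminus ` V) = 1"
      "\<And>v. v \<in> V \<Longrightarrow> measure \<xi>' {v, - v} > 0"
      using simplex by (auto simp: sphere_prob_simplex_def)
    interpret sphere_prob_space \<xi>'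
      using \<xi>(2) by (simp add: sphere_prob_def sphere_prob_space_def sphere_prob_space_axioms_def)
    \<comment> \<open>The mass hypothesis speaks of points of the support. Positive mass on the pair
      makes \<open>v\<close> or \<open>- v\<close> an atom, hence a point of the support, and the
      pair is the same for both.\<close>
    have mv: "m \<le> measure \<xi>' {v, - v}" if v: "v \<in> V" for v
    proof -
      have n: "norm v = 1" using V(1) v by (simp add: orthonormal_basis_def)
      have sing: "{z} \<in> sets \<xi>'" if "norm z = 1" for z
      proof -
        have "{z} = sphere 0 1 \<inter> {z}" using that by auto
        then show ?thesis unfolding sets_eq sphere_borel_def sets_restrict_space
          by (rule image_eqI) simp
      qed
      have "measure \<xi>' ({v} \<union> {- v}) \<le> measure \<xi>' {v} + measure \<xi>' {- v}"
        using n by (intro measure_Un_le sing) auto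
      then have "0 < measure \<xi>' {v} \<or> 0 < measure \<xi>' {- v}"
        using V(3)[OF v] unfolding insert_is_Un[symmetric] by linarith
      then have "v \<in> spt \<xi>' \<or> - v \<in> spt \<xi>'"
        using n atom_in_spt[OF finite_measure_axioms sing] by auto
      then show ?thesis using m by (auto simp: insert_commute)
    qed
    note * = near_simplex_measure[OF V(1) \<xi>(1,2) V(2) \<open>m > 0\<close> mv \<xi>(3) \<delta> a(2) \<beta>[unfolded a(1)]]
    show "energy \<beta> \<xi> \<le> energy \<beta> \<xi>'" by (rule *(1))
    show "energy \<beta> \<xi> < energy \<beta> \<xi>'" if "\<not> is_rotation_of \<xi> \<xi>'" using *(2) that by blast
  qed
qed

end
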